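(* Let $\mathcal{A}$ be an associative $\mathbb{C}$-algebra, let $A \in \operatorname{Mat}_{N,N}(\mathcal{A})$ be a matrix whose entries anticommute with each other, let $\lambda$ be a self-conjugate partition of $n$, and put $\mu=(\mu_1,\ldots,\mu_r)=h(\lambda)$. Then $$\operatorname{tr}(A^{\mu_1}) \cdots \operatorname{tr}(A^{\mu_r}) = i^{-m(\lambda)}\sqrt{\mu_1 \cdots \mu_r}\; \operatorname{imm}^{*\lambda}_n A .$$ In particular, considering the case $\lambda=(k+1,1^k)$, $$\operatorname{tr}(A^{2k+1}) = i^{-k}\sqrt{2k+1}\; \operatorname{imm}^{*(k+1,1^k)}_{2k+1} A .$$
   Context: Elements of a set $X$ are said to anticommute with each other if $xy=-yx$ for all $x,y\in X$ (in particular, $xx=-xx$ for all $x\in X$). $\operatorname{Mat}_{N,N}(\mathcal{A})$ is the set of $N\times N$ matrices with entries in $\mathcal{A}$, $[N]=\{1,\ldots,N\}$, $i$ is the imaginary unit, and $\operatorname{tr}$ is the sum of the diagonal entries. For $X=(x_{ij})\in\operatorname{Mat}_{N,N}(\mathcal{A})$ and $I=(i_1,\ldots,i_n)\in[N]^n$, put $X_{II}=(x_{i_s i_t})_{1\leq s,t\leq n}$ (repetitions allowed). Partitions of $n$ are considered for all $n\geq 0$; for $n=0$ (empty partition, $r=0$) empty products equal $1$. Definition of $h$, $m$ and $\chi^{*\lambda}$. Let $\lambda$ be a self-conjugate partition of $n$ (that is, $\lambda=\lambda'$, where $\lambda'$ is the conjugate partition), and let $r$ be its rank (the length of its main diagonal).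 Put $m(\lambda)=\frac12(n-r)$ (an integer) and $\mu=h(\lambda)=(\mu_1,\ldots,\mu_r)=(2\lambda_1-1,2\lambda_2-3,\ldots,2\lambda_r-(2r-1))$, the sequence of lengths of the diagonal hooks of $\lambda$; it is a partition of $n$ into distinct odd parts. For $\sigma$ in the symmetric group $\mathfrak{S}_n$ of cycle type $\mu$, write $\sigma=(i_{11}\ i_{12}\ \ldots\ i_{1\mu_1})(i_{21}\ \ldots\ i_{2\mu_2})\cdots(i_{r1}\ \ldots\ i_{r\mu_r})$ with cycles ordered by decreasing length, and let $f(\sigma)=1$ (resp. $-1$) if the number of inversions of the sequence $(i_{11},\ldots,i_{1\mu_1},i_{21},\ldots,i_{2\mu_2},\ldots,i_{r1},\ldots,i_{r\mu_r})$ is even (resp. odd); this is well defined since the $\mu_k$ are odd and distinct. Define $\chi^{*\lambda}:\mathfrak{S}_n\to\mathbb{C}$ by $$\chi^{*\lambda}(\sigma)=\begin{cases} f(\sigma)\, i^{m(\lambda)}\sqrt{\mu_1\cdots\mu_r}, & \text{if } \sigma \text{ has cycle type } \mu=h(\lambda),\\ 0,&\text{otherwise.}\end{cases}$$ For an $n\times n$ matrix $X=(x_{ij})$ over $\mathcal{A}$, the twisted immanant is $\operatorname{imm}^{*\lambda}X=\sum_{\sigma\in\mathfrak{S}_n}\chi^{*\lambda}(\sigma)\,x_{1\sigma(1)}\cdots x_{n\sigma(n)}$ (product in this order). For $A\in\operatorname{Mat}_{N,N}(\mathcal{A})$, put $\operatorname{imm}^{*\lambda}_n A=\frac{1}{n!}\sum_{I\in[N]^n}\operatorname{imm}^{*\lambda}A_{II}$.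 *)

theory Defs
  imports
    "Jordan_Normal_Form.Matrix"
    "HOL-Combinatorics.Cycles"
    Complex_Main
begin

text \<open>
  Associative unital algebras over the complex numbers. The superclass is not
  \<open>ring_1\<close>, because that class demands \<open>0 \<noteq> 1\<close> and would exclude the zero algebra.
\<close>

class complex_algebra = ring + monoid_mult +
  fixes scaleC :: "complex \<Rightarrow> 'a \<Rightarrow> 'a"  (infixr \<open>*\<^sub>C\<close> 75)
  assumes scaleC_add_right: "a *\<^sub>C (x + y) = a *\<^sub>C x + a *\<^sub>C y"
    and scaleC_add_left: "(a + b) *\<^sub>C x = a *\<^sub>C x + b *\<^sub>C x"
    and scaleC_scaleC: "a *\<^sub>C b *\<^sub>C x = (a * b) *\<^sub>C x"
    and scaleC_one: "1 *\<^sub>C x = x"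
    and mult_scaleC_left: "a *\<^sub>C x * y = a *\<^sub>C (x * y)"
    and mult_scaleC_right: "x * a *\<^sub>C y = a *\<^sub>C (x * y)"

definition anticommuting :: "'a::ring set \<Rightarrow> bool" where
  "anticommuting X \<longleftrightarrow> (\<forall>x\<in>X. \<forall>y\<in>X. x * y = - (y * x))"

definition trace :: "'a::comm_monoid_add mat \<Rightarrow> 'a" where
  "trace A = (\<Sum>i\<in>{0..<dim_row A}. A $$ (i, i))"

text \<open>The same recursion as \<open>pow_mat\<close>, whose sort \<open>semiring_1\<close> again demands \<open>0 \<noteq> 1\<close>.\<close>

primrec mat_power :: "'a::{semiring_0,monoid_mult} mat \<Rightarrow> nat \<Rightarrow> 'a mat" where
  "mat_power A 0 = 1\<^sub>m (dim_row A)"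
| "mat_power A (Suc k) = mat_power A k * A"


text \<open>
  Partitions are weakly decreasing lists of positive parts. All indices count from 0:
  the part \<open>\<lambda>\<^sub>k\<^sub>+\<^sub>1\<close> is \<open>l ! k\<close>, and the symmetric group acts on \<open>{0..<n}\<close>.
\<close>

definition partition_of :: "nat \<Rightarrow> nat list \<Rightarrow> bool" where
  "partition_of n l \<longleftrightarrow> sorted_wrt (\<ge>) l \<and> 0 \<notin> set l \<and> sum_list l = n"

definition conjugate :: "nat list \<Rightarrow> nat list" where
  "conjugate l =
     (case l of [] \<Rightarrow> [] | p # _ \<Rightarrow> map (\<lambda>j. length (filter (\<lambda>q. j < q) l)) [0..<p])"

definition self_conjugate_partition :: "nat \<Rightarrow> nat list \<Rightarrow> bool" where
  "self_conjugate_partition n l \<longleftrightarrow> partition_of n l \<and> conjugate l = l"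

definition diagonal_rank :: "nat list \<Rightarrow> nat" where
  "diagonal_rank l = card {k. k < length l \<and> k < l ! k}"

text \<open>No truncation occurs: \<open>k < l ! k\<close> holds for all \<open>k < diagonal_rank l\<close>.\<close>

definition diagonal_hooks :: "nat list \<Rightarrow> nat list" where
  "diagonal_hooks l = map (\<lambda>k. 2 * l ! k - (2 * k + 1)) [0..<diagonal_rank l]"

text \<open>
  The division is exact for self-conjugate \<open>l\<close>: then \<open>sum_list l\<close> is the sum of the
  \<open>diagonal_rank l\<close> odd numbers in \<open>diagonal_hooks l\<close>.
\<close>

definition half_defect :: "nat list \<Rightarrow> nat" where
  "half_defect l = (sum_list l - diagonal_rank l) div 2"


definition inversions :: "nat list \<Rightarrow> nat" where
  "inversions xs = card {(i, j). i < j \<and> j < length xs \<and> xs ! j < xs ! i}"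

text \<open>
  \<open>cycle_form n \<mu> s cs\<close>: \<open>cs\<close> writes \<open>s\<close> as a product of disjoint cycles, fixed points
  included, whose lengths are \<open>\<mu>\<close> in this order. The library's \<open>cycle_of_list [a, b, \<dots>]\<close>
  maps \<open>a\<close> to \<open>b\<close>; the direction matters, since reversing all cycles multiplies the sign
  below by \<open>(-1) ^ half_defect l\<close>.
\<close>

definition cycle_form :: "nat \<Rightarrow> nat list \<Rightarrow> (nat \<Rightarrow> nat) \<Rightarrow> nat list list \<Rightarrow> bool" where
  "cycle_form n \<mu> s cs \<longleftrightarrow>
     map length cs = \<mu> \<and> distinct (concat cs) \<and> set (concat cs) = {0..<n} \<and>
     s = foldr (\<circ>) (map cycle_of_list cs) id"

definition has_cycle_type :: "nat \<Rightarrow> nat list \<Rightarrow> (nat \<Rightarrow> nat) \<Rightarrow> bool" where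
  "has_cycle_type n \<mu> s \<longleftrightarrow> (\<exists>cs. cycle_form n \<mu> s cs)"

text \<open>
  For distinct odd lengths \<open>\<mu>\<close> the value does not depend on the chosen cycle form: the
  forms differ only by rotating individual cycles of odd length.
\<close>

definition cycle_sign :: "nat \<Rightarrow> nat list \<Rightarrow> (nat \<Rightarrow> nat) \<Rightarrow> complex" where
  "cycle_sign n \<mu> s =
     (if even (inversions (concat (SOME cs. cycle_form n \<mu> s cs))) then 1 else -1)"

definition twisted_char :: "nat list \<Rightarrow> (nat \<Rightarrow> nat) \<Rightarrow> complex" where
  "twisted_char l s =
     (let n = sum_list l; \<mu> = diagonal_hooks l in
      if has_cycle_type n \<mu> s
      then cycle_sign n \<mu> s * \<i> ^ half_defect l * complex_of_real (sqrt (real (prod_list \<mu>)))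
      else 0)"


definition twisted_imm :: "nat list \<Rightarrow> 'a::complex_algebra mat \<Rightarrow> 'a" where
  "twisted_imm l X =
     (\<Sum>s | s permutes {0..<dim_row X}.
        twisted_char l s *\<^sub>C prod_list (map (\<lambda>i. X $$ (i, s i)) [0..<dim_row X]))"

definition index_mat_by :: "'a mat \<Rightarrow> nat list \<Rightarrow> 'a mat" where
  "index_mat_by A I = mat (length I) (length I) (\<lambda>(s, t). A $$ (I ! s, I ! t))"

definition twisted_imm_sum :: "nat \<Rightarrow> nat list \<Rightarrow> 'a::complex_algebra mat \<Rightarrow> 'a" where
  "twisted_imm_sum n l A =
     (1 / fact n) *\<^sub>C
       (\<Sum>I | length I = n \<and> set I \<subseteq> {0..<dim_row A}. twisted_imm l (index_mat_by A I))"

end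

theory Submission
  imports Defs "HOL-Combinatorics.Multiset_Permutations"
begin

text \<open>
  Fix a permutation \<open>s\<close> of cycle type \<open>\<mu>\<close> and read its cycles one after the other as a word
  \<open>w\<close>. Since the entries anticommute, reordering the factors of
  \<open>A(I 0, I (s 0)) \<cdots> A(I (n-1), I (s (n-1)))\<close> along \<open>w\<close> costs exactly the sign
  \<open>(-1) ^ inversions w\<close>, which cancels the sign in the twisted character; summing over all \<open>I\<close>
  then turns each cycle of length \<open>k\<close> into the sum over closed walks \<open>trace (A ^ k)\<close>.
  So every such \<open>s\<close> contributes the same product of traces, whichever of its cycle forms is
  chosen. As the parts of \<open>\<mu>\<close> are distinct, cycle forms of \<open>s\<close> differ only by rotating the
  cycles, so there are \<open>n! / (\<mu>\<^sub>1 \<cdots> \<mu>\<^sub>r)\<close> such permutations.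
\<close>

subsection \<open>Sums over products of finite sets\<close>

lemma set_Cons_image: "set_Cons A B = (\<lambda>(x, xs). x # xs) ` (A \<times> B)"
  by (auto simp: set_Cons_def)

lemma finite_listset: "\<forall>A\<in>set As. finite A \<Longrightarrow> finite (listset As)"
  by (induction As) (auto simp: set_Cons_image)

lemma in_listset_iff: "xs \<in> listset As \<longleftrightarrow> list_all2 (\<in>) xs As"
  by (induction As arbitrary: xs) (auto simp: set_Cons_def list_all2_Cons2)

text \<open>Distributive law for a product of sums, with the order of the factors kept because
  multiplication need not commute. With \<open>g\<close> constantly 1 it counts
  \<open>listset As\<close>.\<close>

lemma sum_listset_prod_list:
  fixes g :: "'b \<Rightarrow> 'a::{semiring_0,monoid_mult}"
  assumes "\<forall>A\<in>set As. finite A"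
  shows "(\<Sum>xs\<in>listset As. prod_list (map g xs)) = prod_list (map (sum g) As)"
  using assms
proof (induction As)
  case (Cons A As)
  have inj: "inj_on (\<lambda>(x, xs). x # xs) (A \<times> listset As)"
    by (auto simp: inj_on_def)
  have "(\<Sum>xs\<in>listset (A # As). prod_list (map g xs))
      = (\<Sum>(x, xs)\<in>A \<times> listset As. g x * prod_list (map g xs))"
    unfolding listset.simps set_Cons_image
    by (subst sum.reindex[OF inj]) (simp add: case_prod_unfold)
  also have "\<dots> = sum g A * (\<Sum>xs\<in>listset As. prod_list (map g xs))"
    by (simp add: sum_product sum.cartesian_product)
  finally show ?case using Cons by simp
qed simp

lemma card_listset:
  assumes "\<forall>A\<in>set As. finite A"
  shows "card (listset As) = prod_list (map card As)"
proof -
  have "prod_list (map (\<lambda>_. 1) xs) = (1::nat)" for xs :: "'a list"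
    by (induction xs) auto
  moreover have "sum (\<lambda>_. 1::nat) = (card :: 'a set \<Rightarrow> nat)"
    by (rule ext) simp
  ultimately show ?thesis
    using sum_listset_prod_list[OF assms, of "\<lambda>_. 1::nat"] by simp
qed

text \<open>A list of lists with prescribed block lengths is recovered from its concatenation by
  cutting. This turns cycle forms into arrangements of points, and families of closed walks into
  index words.\<close>

lemma bij_betw_concat:
  "bij_betw concat {xss :: 'a list list. map length xss = ms} {xs. length xs = sum_list ms}"
proof (rule bij_betw_imageI)
  show "inj_on concat {xss :: 'a list list. map length xss = ms}"
  proof (rule inj_onI)
    fix xss yss :: "'a list list"
    assume a: "xss \<in> {xss. map length xss = ms}" "yss \<in> {xss. map length xss = ms}"
      and c: "concat xss = concat yss"
    then have m: "map length xss = map length yss" by simp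
    show "xss = yss"
    proof (rule concat_injective[OF c])
      show "length xss = length yss" using m by (rule map_eq_imp_length_eq)
      show "\<forall>(x, y)\<in>set (zip xss yss). length x = length y"
        using m by (auto simp: set_zip map_equality_iff)
    qed
  qed
  have "\<exists>xss. map length xss = ms \<and> concat xss = xs" if "length xs = sum_list ms" for xs :: "'a list"
    using that
  proof (induction ms arbitrary: xs)
    case (Cons m ms)
    then have "length (drop m xs) = sum_list ms" by simp
    from Cons.IH[OF this] obtain xss where "map length xss = ms" "concat xss = drop m xs"
      by blast
    then show ?case using Cons.prems by (intro exI[of _ "take m xs # xss"]) auto
  qed auto
  then show "concat ` {xss :: 'a list list. map length xss = ms} = {xs. length xs = sum_list ms}"
    by (auto simp: length_concat image_iff)
qed

lemma bij_betw_concat_restrict: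
  assumes "\<And>xs. xs \<in> B \<Longrightarrow> length xs = sum_list ms"
  shows "bij_betw concat {xss. map length xss = ms \<and> concat xss \<in> B} B"
proof (rule bij_betw_subset[OF bij_betw_concat[of ms]])
  show "concat ` {xss. map length xss = ms \<and> concat xss \<in> B} = B"
  proof
    show "B \<subseteq> concat ` {xss. map length xss = ms \<and> concat xss \<in> B}"
    proof
      fix xs assume xs: "xs \<in> B"
      with assms have "xs \<in> concat ` {xss. map length xss = ms}"
        using bij_betw_imp_surj_on[OF bij_betw_concat[of ms]] by blast
      with xs show "xs \<in> concat ` {xss. map length xss = ms \<and> concat xss \<in> B}" by auto
    qed
  qed auto
qed auto

subsection \<open>Reordering products of anticommuting elements\<close>

text \<open>Inversions are split by their left position: those at position 0 count the entries below
  \<open>x\<close>, the others are inversions of \<open>xs\<close> shifted by one. This matches one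
  step of insertion sort.\<close>

lemma inversions_Cons:
  "inversions (x # xs) = length (filter (\<lambda>y. y < x) xs) + inversions xs"
proof -
  let ?I = "\<lambda>xs. {(i, j). i < j \<and> j < length xs \<and> xs ! j < xs ! i}"
  let ?J = "{j. j < length xs \<and> xs ! j < x}"
  have fin: "finite (?I xs)"
    by (rule finite_subset[of _ "{..<length xs} \<times> {..<length xs}"]) auto
  have "?I (x # xs) = (\<lambda>j. (0, Suc j)) ` ?J \<union> map_prod Suc Suc ` ?I xs" (is "?L = ?R")
  proof (intro Set.set_eqI iffI)
    fix p assume p: "p \<in> ?L"
    obtain i j where ij: "p = (i, j)" by (cases p)
    show "p \<in> ?R"
      using p unfolding ij by (cases i; cases j) (auto simp: image_iff)
  qed (auto simp: image_iff)
  moreover have "card ((\<lambda>j. (0::nat, Suc j)) ` ?J) = card ?J"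
    by (rule card_image) (auto simp: inj_on_def)
  moreover have "card (map_prod Suc Suc ` ?I xs) = card (?I xs)"
    by (rule card_image) (auto simp: inj_on_def)
  moreover have "card ((\<lambda>j. (0::nat, Suc j)) ` ?J \<union> map_prod Suc Suc ` ?I xs)
      = card ((\<lambda>j. (0::nat, Suc j)) ` ?J) + card (map_prod Suc Suc ` ?I xs)"
    by (rule card_Un_disjoint) (use fin in auto)
  ultimately show ?thesis by (simp add: inversions_def length_filter_conv_card)
qed

text \<open>This is (-1)^k x, written as a case distinction so that it makes sense in any abelian
  group.\<close>

definition signed :: "nat \<Rightarrow> 'a::ab_group_add \<Rightarrow> 'a" where
  "signed k x = (if even k then x else - x)"

lemma signed_add: "signed (k + m) x = signed k (signed m x)"
  by (auto simp: signed_def)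

lemma mult_signed_right: "(x::'a::ring) * signed k y = signed k (x * y)"
  by (simp add: signed_def)

text \<open>\<open>insort\<close> carries \<open>x\<close> past exactly the entries smaller than
  \<open>x\<close>, and each exchange contributes one sign. An equal entry is never passed.\<close>

lemma prod_list_insort_anticommuting:
  fixes a :: "'b::linorder \<Rightarrow> 'a::{ring,monoid_mult}"
  assumes anti: "\<And>x y. x \<in> S \<Longrightarrow> y \<in> S \<Longrightarrow> a x * a y = - (a y * a x)"
    and "sorted ys" "x \<in> S" "set ys \<subseteq> S"
  shows "a x * prod_list (map a ys)
    = signed (length (filter (\<lambda>y. y < x) ys)) (prod_list (map a (insort x ys)))"
  using assms(2-)
proof (induction ys)
  case (Cons y ys)
  show ?case
  proof (cases "x \<le> y")
    case True
    then have "filter (\<lambda>z. z < x) (y # ys) = []"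
      using Cons.prems(1) by (auto simp: filter_empty_conv)
    then show ?thesis using True by (simp add: signed_def del: filter.simps)
  next
    case False
    have "a x * prod_list (map a (y # ys)) = a x * a y * prod_list (map a ys)"
      by (simp add: mult.assoc)
    also have "\<dots> = - (a y * (a x * prod_list (map a ys)))"
      using anti[of x y] Cons.prems by (simp add: mult.assoc)
    also have "\<dots> = - (a y * signed (length (filter (\<lambda>y. y < x) ys)) (prod_list (map a (insort x ys))))"
      using Cons by simp
    finally show ?thesis using False by (auto simp: signed_def not_le)
  qed
qed (simp add: signed_def)

text \<open>Induction along insertion sort: the tail is sorted first, then the head is inserted. The
  number of entries that the head passes is the same for the sorted as for the unsorted
  tail.\<close>

lemma prod_list_sort_anticommuting:
  fixes a :: "nat \<Rightarrow> 'a::{ring,monoid_mult}"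
  assumes anti: "\<And>x y. x \<in> S \<Longrightarrow> y \<in> S \<Longrightarrow> a x * a y = - (a y * a x)"
    and "set xs \<subseteq> S"
  shows "prod_list (map a xs) = signed (inversions xs) (prod_list (map a (sort xs)))"
  using assms(2)
proof (induction xs)
  case Nil
  then show ?case by (simp add: signed_def inversions_def)
next
  case (Cons x xs)
  have "mset (filter (\<lambda>y. y < x) (sort xs)) = mset (filter (\<lambda>y. y < x) xs)"
    by simp
  then have len: "length (filter (\<lambda>y. y < x) (sort xs)) = length (filter (\<lambda>y. y < x) xs)"
    by (metis size_mset)
  have "prod_list (map a (x # xs)) = signed (inversions xs) (a x * prod_list (map a (sort xs)))"
    using Cons by (simp add: mult_signed_right)
  also have "a x * prod_list (map a (sort xs))
      = signed (length (filter (\<lambda>y. y < x) xs)) (prod_list (map a (sort (x # xs))))"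
    using prod_list_insort_anticommuting[of S a "sort xs" x, OF anti] Cons.prems len by simp
  finally show ?case by (simp add: inversions_Cons signed_add[symmetric] add.commute)
qed

subsection \<open>Traces of powers as sums over closed walks\<close>

text \<open>For \<open>J = [j1, ..., jk]\<close> this is a(j1,j2) a(j2,j3) ... a(jk,j1), the weight
  of a closed walk with a marked starting point.\<close>

definition cyclic_product :: "'a::monoid_mult mat \<Rightarrow> nat list \<Rightarrow> 'a" where
  "cyclic_product A J = prod_list (map (index_mat A) (zip J (rotate1 J)))"

abbreviation words :: "nat \<Rightarrow> nat \<Rightarrow> nat list set" where
  "words N k \<equiv> {xs. length xs = k \<and> set xs \<subseteq> {0..<N}}"

lemma finite_words: "finite (words N k)"
  using finite_lists_length_eq[of "{0..<N}" k] by (simp add: conj_commute)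

lemma sum_words_Suc:
  "(\<Sum>xs\<in>words N (Suc k). g xs) = (\<Sum>x\<in>{0..<N}. \<Sum>xs\<in>words N k. g (x # xs))"
proof -
  have eq: "words N (Suc k) = (\<lambda>(x, xs). x # xs) ` ({0..<N} \<times> words N k)"
    by (auto simp: length_Suc_conv image_iff)
  have "inj_on (\<lambda>(x, xs). x # xs) ({0..<N} \<times> words N k)"
    by (auto simp: inj_on_def)
  then show ?thesis
    by (simp only: eq sum.reindex sum.cartesian_product o_def case_prod_unfold)
qed

text \<open>The last letter is split off because \<open>mat_power\<close> multiplies by
  \<open>A\<close> on the right; splitting off the first letter instead singles out the base point
  of a closed walk.\<close>

lemma sum_words_Suc_snoc:
  "(\<Sum>xs\<in>words N (Suc k). g xs) = (\<Sum>x\<in>{0..<N}. \<Sum>xs\<in>words N k. g (xs @ [x]))"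
proof -
  have eq: "words N (Suc k) = (\<lambda>(x, xs). xs @ [x]) ` ({0..<N} \<times> words N k)"
    by (auto simp: length_Suc_conv_rev image_iff)
  have "inj_on (\<lambda>(x, xs). xs @ [x]) ({0..<N} \<times> words N k)"
    by (auto simp: inj_on_def)
  then show ?thesis
    by (simp only: eq sum.reindex sum.cartesian_product o_def case_prod_unfold)
qed

lemma mat_power_carrier:
  assumes "A \<in> carrier_mat N N"
  shows "mat_power A k \<in> carrier_mat N N"
  using assms by (induction k) auto

text \<open>\<open>xs\<close> lists the interior vertices of a walk from \<open>i\<close> to
  \<open>j\<close>: a walk with \<open>k + 1\<close> edges has \<open>k\<close> of them.\<close>

lemma mat_power_Suc_index:
  fixes A :: "'a::{semiring_0,monoid_mult} mat"
  assumes A: "A \<in> carrier_mat N N" and "i < N" "j < N"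
  shows "mat_power A (Suc k) $$ (i, j)
    = (\<Sum>xs\<in>words N k. prod_list (map (index_mat A) (zip (i # xs) (xs @ [j]))))"
  using assms(2-)
proof (induction k arbitrary: j)
  case 0
  have "words N 0 = {[]}" by auto
  moreover have "(\<Sum>x = 0..<N. 1\<^sub>m N $$ (i, x) * A $$ (x, j)) = A $$ (i, j)"
  proof -
    have "(\<Sum>x = 0..<N. 1\<^sub>m N $$ (i, x) * A $$ (x, j))
        = (\<Sum>x\<in>{0..<N}. if x = i then A $$ (x, j) else 0)"
      using 0 by (intro sum.cong) auto
    then show ?thesis using 0 by simp
  qed
  ultimately show ?case
    using A 0 by (simp add: scalar_prod_def)
next
  case (Suc k)
  have zip: "zip (i # xs @ [y]) ((xs @ [y]) @ [j]) = zip (i # xs) (xs @ [y]) @ [(y, j)]" for xs y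
    by (metis append_Cons length_Cons length_append_singleton zip_append zip_Cons_Cons zip_Nil)
  have "mat_power A (Suc (Suc k)) $$ (i, j)
      = (\<Sum>y\<in>{0..<N}. mat_power A (Suc k) $$ (i, y) * A $$ (y, j))"
    using A Suc.prems mat_power_carrier[OF A, of "Suc k"]
    by (subst mat_power.simps) (auto simp: scalar_prod_def simp del: mat_power.simps)
  also have "\<dots> = (\<Sum>y\<in>{0..<N}. \<Sum>xs\<in>words N k.
      prod_list (map (index_mat A) (zip (i # xs @ [y]) ((xs @ [y]) @ [j]))))"
    unfolding zip using Suc by (intro sum.cong) (auto simp: sum_distrib_right)
  finally show ?case by (simp add: sum_words_Suc_snoc)
qed

text \<open>A closed walk is a base point \<open>i\<close> followed by interior vertices
  \<open>xs\<close>, and rotating \<open>i # xs\<close> once gives \<open>xs @ [i]\<close>. At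
  exponent 0 the trace is N times 1, whereas the empty word contributes just 1.\<close>

lemma trace_mat_power:
  fixes A :: "'a::{semiring_0,monoid_mult} mat"
  assumes A: "A \<in> carrier_mat N N" and "k > 0"
  shows "trace (mat_power A k) = (\<Sum>J\<in>words N k. cyclic_product A J)"
proof -
  obtain m where k: "k = Suc m" using \<open>k > 0\<close> gr0_implies_Suc by blast
  have "dim_row (mat_power A k) = N" using mat_power_carrier[OF A, of k] by auto
  then have "trace (mat_power A k) = (\<Sum>i\<in>{0..<N}. mat_power A (Suc m) $$ (i, i))"
    by (simp add: trace_def k del: mat_power.simps)
  also have "\<dots> = (\<Sum>i\<in>{0..<N}. \<Sum>xs\<in>words N m.
      prod_list (map (index_mat A) (zip (i # xs) (xs @ [i]))))"
    by (intro sum.cong refl mat_power_Suc_index[OF A]) auto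
  also have "\<dots> = (\<Sum>J\<in>words N k. cyclic_product A J)"
    by (simp add: k sum_words_Suc cyclic_product_def)
  finally show ?thesis .
qed

lemma list_all2_words_iff:
  "list_all2 (\<in>) Js (map (words N) ms)
    \<longleftrightarrow> map length Js = ms \<and> set (concat Js) \<subseteq> {0..<N}"
proof (induction Js arbitrary: ms)
  case (Cons J Js)
  show ?case by (cases ms) (simp_all add: Cons conj_ac)
qed auto

text \<open>Distributive law over the traces in their order: one closed walk of length
  \<open>k\<close> is chosen for each part \<open>k\<close>. The index set is phrased through
  \<open>concat\<close> so that it can be compared with index words.\<close>

lemma prod_traces:
  fixes A :: "'a::{semiring_0,monoid_mult} mat"
  assumes A: "A \<in> carrier_mat N N" and "0 \<notin> set ms"
  shows "prod_list (map (\<lambda>k. trace (mat_power A k)) ms)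
    = (\<Sum>Js | map length Js = ms \<and> concat Js \<in> words N (sum_list ms).
         prod_list (map (cyclic_product A) Js))"
proof -
  have "{Js. map length Js = ms \<and> concat Js \<in> words N (sum_list ms)} = listset (map (words N) ms)"
    by (intro Set.set_eqI) (auto simp only: in_listset_iff list_all2_words_iff length_concat mem_Collect_eq)
  moreover have "map (\<lambda>k. trace (mat_power A k)) ms = map (sum (cyclic_product A)) (map (words N) ms)"
    using assms(2) by (auto intro!: trace_mat_power[OF A] gr0I)
  moreover have "(\<Sum>Js\<in>listset (map (words N) ms). prod_list (map (cyclic_product A) Js))
      = prod_list (map (sum (cyclic_product A)) (map (words N) ms))"
    by (rule sum_listset_prod_list) (auto simp: finite_words)
  ultimately show ?thesis by (simp only:)
qed

subsection \<open>Cycle forms\<close>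

lemma foldr_cycles_Cons:
  "foldr (\<circ>) (map cycle_of_list (c # cs)) id x
    = cycle_of_list c (foldr (\<circ>) (map cycle_of_list cs) id x)"
  by simp

lemma foldr_cycles_outside:
  "x \<notin> set (concat cs) \<Longrightarrow> foldr (\<circ>) (map cycle_of_list cs) id x = x"
  by (induction cs) (auto simp: id_outside_supp)

text \<open>The cycles are disjoint, so those other than \<open>c\<close> fix both \<open>x\<close>
  and its image under \<open>c\<close>.\<close>

lemma foldr_cycles_inside:
  "distinct (concat cs) \<Longrightarrow> c \<in> set cs \<Longrightarrow> x \<in> set c \<Longrightarrow>
    foldr (\<circ>) (map cycle_of_list cs) id x = cycle_of_list c x"
proof (induction cs)
  case (Cons d cs)
  show ?case
  proof (cases "c = d")
    case True
    then have "x \<notin> set (concat cs)" using Cons.prems by auto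
    from foldr_cycles_outside[OF this] True show ?thesis
      by (simp only: foldr_cycles_Cons)
  next
    case False
    then have c: "c \<in> set cs" using Cons.prems by auto
    have "cycle_of_list c x \<in> set c"
      using Cons.prems(3) permutes_in_image[OF cycle_permutes] by metis
    with c Cons.prems have "cycle_of_list c x \<notin> set d" by auto
    then show ?thesis using Cons c by (simp add: id_outside_supp)
  qed
qed simp

lemma cycle_form_rotate1:
  assumes "cycle_form n ms s cs" "c \<in> set cs"
  shows "map s c = rotate1 c"
proof -
  have d: "distinct (concat cs)" and s: "s = foldr (\<circ>) (map cycle_of_list cs) id"
    using assms by (auto simp: cycle_form_def)
  have "distinct c" using d assms(2) by (simp add: distinct_concat_iff)
  have "map s c = map (cycle_of_list c) c"
    using foldr_cycles_inside[OF d assms(2)] by (simp add: s)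
  also have "\<dots> = rotate1 c" using cyclic_rotation[OF \<open>distinct c\<close>, of 1] by simp
  finally show ?thesis .
qed

lemma cycle_form_permutes:
  assumes "cycle_form n ms s cs"
  shows "s permutes {0..<n}"
proof -
  have "foldr (\<circ>) (map cycle_of_list cs) id permutes S" if "set (concat cs) \<subseteq> S" for S
    using that
    by (induction cs)
      (auto intro!: permutes_compose permutes_id permutes_subset[OF cycle_permutes])
  then show ?thesis using assms by (simp add: cycle_form_def)
qed

lemma cycle_form_funpow:
  assumes "cycle_form n ms s cs" "c \<in> set cs"
  shows "map (s ^^ k) c = rotate k c"
proof (induction k)
  case (Suc k)
  have "map s (rotate k c) = rotate k (map s c)" by (simp add: rotate_map)
  also have "\<dots> = rotate (Suc k) c"
    using cycle_form_rotate1[OF assms] by (simp add: rotate1_rotate_swap)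
  finally show ?case using Suc by (metis funpow.simps(2) map_map)
qed simp

text \<open>Read from its entry at position \<open>t\<close>, a cycle runs through the iterates of
  \<open>s\<close> on that entry. So the rotated list depends only on \<open>s\<close>, this entry
  and the length.\<close>

lemma cycle_form_rotate_position:
  assumes "cycle_form n ms s cs" "c \<in> set cs" "t < length c"
  shows "rotate t c = map (\<lambda>j. (s ^^ j) (c ! t)) [0..<length c]"
proof (rule nth_equalityI)
  fix j assume j: "j < length (rotate t c)"
  have "(s ^^ j) (c ! t) = rotate j c ! t"
    using assms(3) cycle_form_funpow[OF assms(1,2), of j] by (metis nth_map)
  then show "rotate t c ! j = map (\<lambda>j. (s ^^ j) (c ! t)) [0..<length c] ! j"
    using j assms(3) by (simp add: nth_rotate add.commute)
qed simp

text \<open>The orbit of \<open>x\<close> under \<open>s\<close> is the set of entries of its cycle,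
  so the length of this cycle can be read off from \<open>s\<close> and \<open>x\<close>
  alone.\<close>

lemma cycle_form_orbit:
  assumes "cycle_form n ms s cs" "c \<in> set cs" "x \<in> set c"
  shows "card (range (\<lambda>j. (s ^^ j) x)) = length c"
proof -
  have "distinct c" using assms by (auto simp: cycle_form_def distinct_concat_iff)
  obtain t where t: "t < length c" "x = c ! t" using assms(3) by (metis in_set_conv_nth)
  have "(s ^^ j) x \<in> set c" for j
  proof -
    have "(s ^^ j) x \<in> set (map (s ^^ j) c)" using assms(3) by simp
    then show ?thesis by (simp only: cycle_form_funpow[OF assms(1,2)] set_rotate)
  qed
  moreover have "set c \<subseteq> range (\<lambda>j. (s ^^ j) x)"
  proof -
    have "set c = set (rotate t c)" by simp
    also have "\<dots> \<subseteq> range (\<lambda>j. (s ^^ j) x)"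
      unfolding cycle_form_rotate_position[OF assms(1,2) t(1)] t(2) by auto
    finally show ?thesis .
  qed
  ultimately have "range (\<lambda>j. (s ^^ j) x) = set c" by auto
  then show ?thesis using \<open>distinct c\<close> by (simp add: distinct_card)
qed

section \<open>Rotations of cycles and the number of permutations of a given cycle type\<close>

abbreviation rotations :: "'a list \<Rightarrow> 'a list set" where
  "rotations c \<equiv> (\<lambda>t. rotate t c) ` {0..<length c}"

text \<open>Since the entries are distinct, a rotation is determined by its first entry.\<close>

lemma card_rotations:
  assumes "distinct c"
  shows "card (rotations c) = length c"
proof -
  have "inj_on (\<lambda>t. rotate t c) {0..<length c}"
  proof (rule inj_onI)
    fix t u assume t: "t \<in> {0..<length c}" and u: "u \<in> {0..<length c}"
      and "rotate t c = rotate u c"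
    then have "rotate t c ! 0 = rotate u c ! 0" by simp
    moreover have "0 < length c" using t by auto
    ultimately have "c ! t = c ! u" using t u by (simp add: nth_rotate)
    then show "t = u" using assms t u by (simp add: nth_eq_iff_index_eq)
  qed
  then show ?thesis by (simp add: card_image)
qed

lemma cycle_of_list_rotate:
  assumes "distinct c"
  shows "cycle_of_list (rotate t c) = cycle_of_list c"
proof
  fix x
  show "cycle_of_list (rotate t c) x = cycle_of_list c x"
  proof (cases "x \<in> set c")
    case True
    have "map (cycle_of_list (rotate t c)) (rotate t c) = rotate1 (rotate t c)"
      using cyclic_rotation[of "rotate t c" 1] assms by simp
    also have "\<dots> = map (cycle_of_list c) (rotate t c)"
      using cyclic_rotation[OF assms, of 1]
      by (simp add: rotate1_rotate_swap rotate_map[symmetric])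
    finally show ?thesis using True by (auto simp: map_eq_conv)
  qed (simp add: id_outside_supp)
qed

text \<open>A point lies in cycles of equal length in both forms, namely the size of its orbit.
  Distinct lengths force the same position in the list, and there the two cycles differ by a
  rotation. Conversely, rotating cycles changes neither their lengths, nor their supports, nor the
  permutation.\<close>

lemma cycle_form_fibre:
  assumes cf: "cycle_form n ms s cs" and "distinct ms" "0 \<notin> set ms"
  shows "{ds. cycle_form n ms s ds} = listset (map rotations cs)"
proof (intro Set.set_eqI iffI; clarify?)
  fix ds assume df: "cycle_form n ms s ds"
  have lens: "map length cs = ms" "map length ds = ms"
    and sets: "set (concat cs) = {0..<n}" "set (concat ds) = {0..<n}"
    using cf df by (auto simp: cycle_form_def)
  have ll: "length cs = length ms" "length ds = length ms" using lens by (metis length_map)+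
  have nthlen: "length (cs ! k) = ms ! k" "length (ds ! k) = ms ! k" if "k < length ms" for k
    using lens that ll by (metis nth_map)+
  show "ds \<in> listset (map rotations cs)"
    unfolding in_listset_iff list_all2_conv_all_nth
  proof (intro conjI allI impI)
    show "length ds = length (map rotations cs)" using ll by simp
    fix k assume "k < length ds"
    then have k: "k < length ms" using ll by simp
    have dk: "ds ! k \<in> set ds" using k ll by simp
    have pos: "0 < length (ds ! k)"
      using nthlen(2)[OF k] assms(3) k by (metis gr0I nth_mem)
    define x where "x = ds ! k ! 0"
    have x: "x \<in> set (ds ! k)" using pos by (simp add: x_def)
    then have "x \<in> set (concat cs)" using dk sets by auto
    then obtain j where j: "j < length ms" "x \<in> set (cs ! j)"
      using ll by (metis UN_E in_set_conv_nth set_concat)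
    then have cj: "cs ! j \<in> set cs" using ll by simp
    have "ms ! j = ms ! k"
      using cycle_form_orbit[OF cf cj j(2)] cycle_form_orbit[OF df dk x] nthlen j(1) k by simp
    then have jk: "j = k" using assms(2) j(1) k by (simp add: nth_eq_iff_index_eq)
    obtain t where t: "t < length (cs ! k)" "x = cs ! k ! t"
      using j(2) jk by (metis in_set_conv_nth)
    \<comment> \<open>Both lists run through the iterates of \<open>s\<close> on \<open>x\<close>,
      and they have the same length.\<close>
    have "rotate t (cs ! k) = rotate 0 (ds ! k)"
      using cycle_form_rotate_position[OF cf cj[unfolded jk] t(1)]
        cycle_form_rotate_position[OF df dk pos] nthlen[OF k] t(2) x_def by simp
    then show "ds ! k \<in> map rotations cs ! k"
      using t(1) k ll by (auto simp: image_iff intro!: bexI[of _ t])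
  qed
next
  fix ds assume "ds \<in> listset (map rotations cs)"
  then have rot: "list_all2 (\<lambda>d c. d \<in> rotations c) ds cs"
    by (simp add: in_listset_iff list_all2_map2)
  have dist: "\<forall>c\<in>set cs. distinct c"
    using cf by (auto simp: cycle_form_def distinct_concat_iff)
  have "map length ds = map length cs \<and> map set ds = map set cs
      \<and> map cycle_of_list ds = map cycle_of_list cs"
    using rot dist by (induction rule: list_all2_induct) (auto simp: cycle_of_list_rotate)
  then have eqs: "map length ds = map length cs" "map set ds = map set cs"
      "map cycle_of_list ds = map cycle_of_list cs" by auto
  have set: "set (concat ds) = set (concat cs)"
    using arg_cong[OF eqs(2), of set] by simp
  \<comment> \<open>Distinctness follows by counting: \<open>concat ds\<close> has the same set and
    the same length as the distinct list \<open>concat cs\<close>.\<close>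
  have "length (concat ds) = length (concat cs)"
    using eqs(1) by (simp add: length_concat)
  then have "distinct (concat ds)"
    using set cf by (metis card_distinct cycle_form_def distinct_card)
  then show "cycle_form n ms s ds"
    using cf eqs set by (simp add: cycle_form_def)
qed

text \<open>Double counting: the n! arrangements of \<open>{0..<n}\<close>, cut into blocks of
  lengths \<open>ms\<close>, are grouped by the permutation they write. Each group has
  \<open>prod_list ms\<close> members, one for each choice of rotations of the cycles.\<close>

lemma card_has_cycle_type:
  assumes "distinct ms" "0 \<notin> set ms" "sum_list ms = n"
  shows "card {s. has_cycle_type n ms s} * prod_list ms = fact n"
proof -
  let ?T = "{s. has_cycle_type n ms s}"
  let ?C = "{cs. map length cs = ms \<and> concat cs \<in> permutations_of_set {0..<n}}"
  have "?T \<subseteq> {s. s permutes {0..<n}}"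
    by (auto simp: has_cycle_type_def dest: cycle_form_permutes)
  then have finT: "finite ?T" by (rule finite_subset) (simp add: finite_permutations)
  have bij: "bij_betw concat ?C (permutations_of_set {0..<n})"
    by (rule bij_betw_concat_restrict)
      (use assms(3) in \<open>auto simp: permutations_of_set_def dest: distinct_card\<close>)
  have C: "?C = (\<Union>s\<in>?T. {cs. cycle_form n ms s cs})"
    by (auto simp: has_cycle_type_def cycle_form_def permutations_of_set_def)
  have fibre: "card {cs. cycle_form n ms s cs} = prod_list ms
      \<and> finite {cs. cycle_form n ms s cs}" if s: "s \<in> ?T" for s
  proof -
    obtain cs where cf: "cycle_form n ms s cs" using s by (auto simp: has_cycle_type_def)
    have d: "\<forall>c\<in>set cs. distinct c" and lens: "map length cs = ms"
      using cf by (auto simp: cycle_form_def distinct_concat_iff)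
    have fin: "\<forall>S\<in>set (map rotations cs). finite S" by auto
    have "map card (map rotations cs) = map length cs"
      using d by (simp add: card_rotations)
    then have "card (listset (map rotations cs)) = prod_list ms"
      using card_listset[OF fin] lens by simp
    then show ?thesis
      using cycle_form_fibre[OF cf assms(1,2)] finite_listset[OF fin] by simp
  qed
  have "fact n = card ?C"
    using bij_betw_same_card[OF bij] by simp
  also have "\<dots> = (\<Sum>s\<in>?T. card {cs. cycle_form n ms s cs})"
    unfolding C
  proof (rule card_UN_disjoint)
    show "\<forall>s\<in>?T. finite {cs. cycle_form n ms s cs}" using fibre by blast
  qed (use finT in \<open>auto simp: cycle_form_def\<close>)
  also have "\<dots> = card ?T * prod_list ms"
    using fibre by simp
  finally show ?thesis by simp
qed

subsection \<open>The contribution of one permutation\<close>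

text \<open>Valid for every cycle form \<open>cs\<close> of \<open>s\<close>, hence in particular
  for the one that \<open>cycle_sign\<close> picks.\<close>

lemma cycle_form_sum:
  fixes A :: "'a::{ring,monoid_mult} mat"
  assumes A: "A \<in> carrier_mat N N" and anti: "anticommuting (elements_mat A)"
    and cf: "cycle_form n ms s cs" and ms: "0 \<notin> set ms" "sum_list ms = n"
  shows "(\<Sum>I\<in>words N n. prod_list (map (\<lambda>i. A $$ (I ! i, I ! s i)) [0..<n]))
    = signed (inversions (concat cs)) (prod_list (map (\<lambda>k. trace (mat_power A k)) ms))"
proof -
  let ?w = "concat cs"
  let ?J = "{Js. map length Js = ms \<and> concat Js \<in> words N n}"
  have lens: "map length cs = ms" and dw: "distinct ?w" and sw: "set ?w = {0..<n}"
    using cf by (auto simp: cycle_form_def)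
  have lw: "length ?w = n" using lens ms(2) by (simp add: length_concat)
  have sort: "sort ?w = [0..<n]"
    by (rule sorted_distinct_set_unique) (use dw sw in auto)
  have s_less: "s i < n" if "i < n" for i
    using permutes_in_image[OF cycle_form_permutes[OF cf], of i] that by simp
  have entry: "A $$ (I ! i, I ! s i) \<in> elements_mat A" if "I \<in> words N n" "i < n" for I i
    using that s_less[of i] by (intro elements_matI[OF A]) (auto simp: subset_iff)
  have reorder: "prod_list (map (\<lambda>i. A $$ (I ! i, I ! s i)) [0..<n])
      = signed (inversions ?w) (prod_list (map (cyclic_product A) (map (map ((!) I)) cs)))"
    if I: "I \<in> words N n" for I
  proof -
    let ?a = "\<lambda>i. A $$ (I ! i, I ! s i)"
    have "prod_list (map ?a ?w) = signed (inversions ?w) (prod_list (map ?a (sort ?w)))"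
    proof (rule prod_list_sort_anticommuting[of "{0..<n}"])
      fix x y assume "x \<in> {0..<n}" "y \<in> {0..<n}"
      then have "?a x \<in> elements_mat A" "?a y \<in> elements_mat A"
        using entry[OF I] by auto
      then show "?a x * ?a y = - (?a y * ?a x)"
        using anti unfolding anticommuting_def by blast
    qed (simp only: sw)
    \<comment> \<open>The sign is its own inverse, so it can be moved to the other side.\<close>
    then have "prod_list (map ?a [0..<n]) = signed (inversions ?w) (prod_list (map ?a ?w))"
      by (simp add: sort signed_def)
    also have "prod_list (map ?a (concat ds)) = prod_list (map (cyclic_product A) (map (map ((!) I)) ds))"
      if "set ds \<subseteq> set cs" for ds
      using that
    proof (induction ds)
      case (Cons d ds)
      \<comment> \<open>Along a cycle, \<open>s\<close> sends each point to the next one, so the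
        column index of each factor is the row index of the following factor, cyclically.\<close>
      have "map ?a d = map (index_mat A) (zip (map ((!) I) d) (map ((!) I) (map s d)))"
        by (rule nth_equalityI) simp_all
      also have "map s d = rotate1 d"
        using Cons.prems by (intro cycle_form_rotate1[OF cf]) simp
      finally have "prod_list (map ?a d) = cyclic_product A (map ((!) I) d)"
        by (simp only: cyclic_product_def rotate1_map)
      then show ?case using Cons by simp
    qed simp
    from this[OF order_refl] have "prod_list (map ?a ?w)
      = prod_list (map (cyclic_product A) (map (map ((!) I)) cs))" .
    finally show ?thesis .
  qed
  \<comment> \<open>\<open>?w\<close> lists every position once, so reading \<open>I\<close> along
    \<open>?w\<close> merely permutes the finite set of index words.\<close>
  have perm: "bij_betw (\<lambda>I. map ((!) I) ?w) (words N n) (words N n)"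
  proof -
    have inj: "inj_on (\<lambda>I. map ((!) I) ?w) (words N n)"
    proof (rule inj_onI)
      fix I I' assume I: "I \<in> words N n" "I' \<in> words N n" and eq: "map ((!) I) ?w = map ((!) I') ?w"
      have agree: "I ! i = I' ! i" if "i < n" for i
        using eq that unfolding map_eq_conv sw by simp
      show "I = I'"
      proof (rule nth_equalityI)
        fix i assume "i < length I"
        then show "I ! i = I' ! i" using I(1) by (intro agree) simp
      qed (use I in simp)
    qed
    have "(\<lambda>I. map ((!) I) ?w) ` words N n \<subseteq> words N n"
    proof (rule image_subsetI)
      fix I assume I: "I \<in> words N n"
      have "set (map ((!) I) ?w) = (!) I ` {0..<n}" by (simp only: set_map sw)
      also have "\<dots> \<subseteq> {0..<N}" using I by (auto simp: subset_iff)
      finally show "map ((!) I) ?w \<in> words N n" using lw by simp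
    qed
    then show ?thesis
      using inj endo_inj_surj[OF finite_words] by (auto simp: bij_betw_def)
  qed
  have cc: "bij_betw concat ?J (words N n)"
    by (rule bij_betw_concat_restrict) (use ms(2) in auto)
  \<comment> \<open>This map is \<open>perm\<close> followed by cutting into blocks, the inverse of
    \<open>concat\<close>. Hence the closed walks on the different cycles vary
    independently.\<close>
  have "bij_betw (\<lambda>I. map (map ((!) I)) cs) (words N n) ?J"
  proof (rule bij_betw_imageI)
    have conc: "concat (map (map ((!) I)) cs) = map ((!) I) ?w" for I :: "nat list"
      by (simp add: map_concat)
    show "inj_on (\<lambda>I. map (map ((!) I)) cs) (words N n)"
    proof (rule inj_onI)
      fix I I' assume I: "I \<in> words N n" "I' \<in> words N n"
        and "map (map ((!) I)) cs = map (map ((!) I')) cs"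
      then have "map ((!) I) ?w = map ((!) I') ?w" by (simp only: conc[symmetric])
      then show "I = I'" using I by (rule inj_onD[OF bij_betw_imp_inj_on[OF perm]])
    qed
    have mem: "map (map ((!) I)) cs \<in> ?J" if "I \<in> words N n" for I
    proof (rule CollectI, rule conjI)
      show "map length (map (map ((!) I)) cs) = ms" unfolding lens[symmetric] by simp
      show "concat (map (map ((!) I)) cs) \<in> words N n"
        unfolding conc using bij_betwE[OF perm] that by blast
    qed
    show "(\<lambda>I. map (map ((!) I)) cs) ` words N n = ?J"
    proof (rule subset_antisym)
      show "?J \<subseteq> (\<lambda>I. map (map ((!) I)) cs) ` words N n"
      proof
        fix Js assume Js: "Js \<in> ?J"
        then have "concat Js \<in> (\<lambda>I. map ((!) I) ?w) ` words N n"
          using bij_betw_imp_surj_on[OF perm] by simp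
        then obtain I where I: "I \<in> words N n" "concat Js = concat (map (map ((!) I)) cs)"
          unfolding conc by blast
        then have "Js = map (map ((!) I)) cs"
          using Js mem[OF I(1)] by (intro inj_onD[OF bij_betw_imp_inj_on[OF cc]])
        then show "Js \<in> (\<lambda>I. map (map ((!) I)) cs) ` words N n" using I by blast
      qed
    qed (use mem in blast)
  qed
  then have "(\<Sum>I\<in>words N n. prod_list (map (cyclic_product A) (map (map ((!) I)) cs)))
      = (\<Sum>Js\<in>?J. prod_list (map (cyclic_product A) Js))"
    by (rule sum.reindex_bij_betw)
  also have "\<dots> = prod_list (map (\<lambda>k. trace (mat_power A k)) ms)"
    using prod_traces[OF A ms(1)] ms(2) by simp
  finally have total: "(\<Sum>I\<in>words N n. prod_list (map (cyclic_product A) (map (map ((!) I)) cs)))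
      = prod_list (map (\<lambda>k. trace (mat_power A k)) ms)" .
  have "(\<Sum>I\<in>words N n. prod_list (map (\<lambda>i. A $$ (I ! i, I ! s i)) [0..<n]))
      = (\<Sum>I\<in>words N n. signed (inversions ?w)
          (prod_list (map (cyclic_product A) (map (map ((!) I)) cs))))"
    by (rule sum.cong[OF refl reorder])
  also have "\<dots> = signed (inversions ?w) (prod_list (map (\<lambda>k. trace (mat_power A k)) ms))"
    unfolding total[symmetric] by (simp add: signed_def sum_negf)
  finally show ?thesis .
qed

subsection \<open>Scalars\<close>

lemma scaleC_zero_left: "0 *\<^sub>C (x::'a::complex_algebra) = 0"
  using scaleC_add_left[of 0 0 x] by simp

lemma scaleC_zero_right: "c *\<^sub>C (0::'a::complex_algebra) = 0"
  using scaleC_add_right[of c 0 "0::'a"] by simp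

lemma scaleC_minus_left: "(- c) *\<^sub>C (x::'a::complex_algebra) = - (c *\<^sub>C x)"
  using scaleC_add_left[of "- c" c x] by (simp add: scaleC_zero_left eq_neg_iff_add_eq_0)

lemma scaleC_minus_right: "c *\<^sub>C (- x::'a::complex_algebra) = - (c *\<^sub>C x)"
  using scaleC_add_right[of c "- x" x] by (simp add: scaleC_zero_right eq_neg_iff_add_eq_0)

lemma scaleC_sum_right: "c *\<^sub>C sum f S = (\<Sum>x\<in>S. c *\<^sub>C (f x::'a::complex_algebra))"
  by (induction S rule: infinite_finite_induct) (auto simp: scaleC_zero_right scaleC_add_right)

lemma sum_const_scaleC: "(\<Sum>x\<in>S. c *\<^sub>C (y::'a::complex_algebra)) = (of_nat (card S) * c) *\<^sub>C y"
  by (induction S rule: infinite_finite_induct)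
    (auto simp: scaleC_zero_left scaleC_add_left[symmetric] algebra_simps)

subsection \<open>Diagonal hooks of self-conjugate partitions\<close>

lemma downward_closed_eq_lessThan_card:
  assumes "finite (D::nat set)" "\<And>x y. x \<in> D \<Longrightarrow> y < x \<Longrightarrow> y \<in> D"
  shows "D = {..<card D}"
proof -
  \<comment> \<open>\<open>m\<close> is the least number outside \<open>D\<close>.\<close>
  obtain m where m: "m \<notin> D" "\<forall>k<m. k \<in> D"
    using assms(1) ex_least_nat_le[of "\<lambda>m. m \<notin> D"] by (metis ex_new_if_finite infinite_UNIV_nat exists_least_iff)
  have "D = {..<m}"
    using m assms(2) by (metis lessThan_iff linorder_neqE_nat subsetI subset_antisym)
  then show ?thesis by simp
qed

lemma partition_nth_mono:
  assumes "partition_of n l" "i \<le> j" "j < length l"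
  shows "l ! j \<le> l ! i"
  using assms by (cases "i = j") (auto simp: partition_of_def sorted_wrt_iff_nth_less)

text \<open>The index grows while the parts do not, so the condition passes to smaller
  indices.\<close>

lemma diagonal_eq_lessThan_rank:
  assumes "partition_of n l"
  shows "{k. k < length l \<and> k < l ! k} = {..<diagonal_rank l}"
  unfolding diagonal_rank_def
proof (rule downward_closed_eq_lessThan_card)
  fix x y assume "x \<in> {k. k < length l \<and> k < l ! k}" "y < x"
  then show "y \<in> {k. k < length l \<and> k < l ! k}"
    using partition_nth_mono[OF assms, of y x] by auto
qed simp

text \<open>Reflection of the diagram in its diagonal. The rows longer than \<open>j\<close> form an
  initial segment that contains \<open>i\<close>, and its size is the conjugate part with index
  \<open>j\<close>, which equals \<open>l ! j\<close>.\<close>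

lemma self_conjugate_sym:
  assumes "self_conjugate_partition n l" "i < length l" "j < l ! i"
  shows "j < length l \<and> i < l ! j"
proof -
  have p: "partition_of n l" and c: "conjugate l = l"
    using assms by (auto simp: self_conjugate_partition_def)
  have ne: "l \<noteq> []" using assms by auto
  then have conj: "conjugate l = map (\<lambda>j. length (filter (\<lambda>q. j < q) l)) [0..<l ! 0]"
    by (cases l) (auto simp: conjugate_def)
  \<comment> \<open>The conjugate has \<open>l ! 0\<close> parts, so the number of rows bounds the
    column indices.\<close>
  have len: "length l = l ! 0" using arg_cong[OF c, of length] by (simp add: conj)
  have j: "j < length l" using partition_nth_mono[OF p, of 0 i] assms len by simp
  let ?D = "{k. k < length l \<and> j < l ! k}"
  have "?D = {..<card ?D}"
  proof (rule downward_closed_eq_lessThan_card)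
    fix x y assume "x \<in> ?D" "y < x"
    then show "y \<in> ?D" using partition_nth_mono[OF p, of y x] by auto
  qed simp
  moreover have "i \<in> ?D" using assms by simp
  ultimately have "i < card ?D" by blast
  also have "card ?D = length (filter (\<lambda>q. j < q) l)" by (simp add: length_filter_conv_card)
  also have "\<dots> = conjugate l ! j" using j len by (simp add: conj)
  finally show ?thesis using j c by simp
qed

text \<open>Down the diagonal the parts weakly decrease while the subtracted odd number strictly
  grows; each difference is positive because \<open>k < l ! k\<close>.\<close>

lemma diagonal_hooks_distinct:
  assumes "partition_of n l"
  shows "distinct (diagonal_hooks l)" "0 \<notin> set (diagonal_hooks l)"
proof -
  have d: "k < length l \<and> k < l ! k" if "k < diagonal_rank l" for k
    using diagonal_eq_lessThan_rank[OF assms] that by blast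
  have less: "2 * l ! k - (2 * k + 1) < 2 * l ! j - (2 * j + 1)"
    if "j < k" "k < diagonal_rank l" for j k
    using d[OF that(2)] partition_nth_mono[OF assms, of j k] that by linarith
  have "inj_on (\<lambda>k. 2 * l ! k - (2 * k + 1)) {0..<diagonal_rank l}"
  proof (rule linorder_inj_onI')
    fix i j assume "i \<in> {0..<diagonal_rank l}" "j \<in> {0..<diagonal_rank l}" "i < j"
    then show "2 * l ! i - (2 * i + 1) \<noteq> 2 * l ! j - (2 * j + 1)"
      using less[of i j] by simp
  qed
  then show "distinct (diagonal_hooks l)" by (simp add: diagonal_hooks_def distinct_map)
  show "0 \<notin> set (diagonal_hooks l)"
    using d by (force simp: diagonal_hooks_def)
qed

text \<open>A cell \<open>(i, j)\<close> of the diagram lies on the diagonal hook with index \<open>min i j\<close>.\<close>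

lemma sum_diagonal_hooks:
  assumes sc: "self_conjugate_partition n l"
  shows "sum_list (diagonal_hooks l) = n"
proof -
  have p: "partition_of n l" using sc by (simp add: self_conjugate_partition_def)
  let ?r = "diagonal_rank l"
  have D: "{k. k < length l \<and> k < l ! k} = {..<?r}" by (rule diagonal_eq_lessThan_rank[OF p])
  let ?S = "SIGMA i:{..<length l}. {..<l ! i}"
  \<comment> \<open>Row \<open>k\<close> from the diagonal on, together with column \<open>k\<close>
    strictly below the diagonal. By symmetry the column ends at the same bound \<open>l ! k\<close>
    as the row.\<close>
  let ?H = "\<lambda>k. (\<lambda>j. (k, j)) ` {k..<l ! k} \<union> (\<lambda>i. (i, k)) ` {Suc k..<l ! k}"
  have S: "?S = (\<Union>k\<in>{..<?r}. ?H k)"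
  proof (intro Set.set_eqI iffI)
    fix c assume "c \<in> ?S"
    then obtain i j where c: "c = (i, j)" "i < length l" "j < l ! i" by auto
    have s: "j < length l" "i < l ! j" using self_conjugate_sym[OF sc c(2,3)] by auto
    have "min i j \<in> {k. k < length l \<and> k < l ! k}"
      using c s by (auto simp: min_def)
    then have r: "min i j \<in> {..<?r}" unfolding D .
    have "c \<in> ?H (min i j)" using c s by (auto simp: min_def)
    with r show "c \<in> (\<Union>k\<in>{..<?r}. ?H k)" by blast
  next
    fix c assume "c \<in> (\<Union>k\<in>{..<?r}. ?H k)"
    then obtain k where k: "k < ?r" "c \<in> ?H k" by auto
    have "k < length l" using D k(1) by blast
    then show "c \<in> ?S" using k(2) self_conjugate_sym[OF sc, of k] by auto
  qed
  have cardH: "card (?H k) = 2 * l ! k - (2 * k + 1)" if "k < ?r" for k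
  proof -
    have "k < l ! k" using D that by blast
    moreover have "card (?H k) = card ((\<lambda>j. (k, j)) ` {k..<l ! k}) + card ((\<lambda>i. (i, k)) ` {Suc k..<l ! k})"
      by (rule card_Un_disjoint) auto
    moreover have "card ((\<lambda>j. (k, j)) ` {k..<l ! k}) = l ! k - k"
      by (subst card_image) (auto simp: inj_on_def)
    moreover have "card ((\<lambda>i. (i, k)) ` {Suc k..<l ! k}) = l ! k - Suc k"
      by (subst card_image) (auto simp: inj_on_def)
    ultimately show ?thesis by simp
  qed
  have "n = card ?S"
    using p by (simp add: partition_of_def sum_list_sum_nth atLeast0LessThan)
  also have "\<dots> = (\<Sum>k<?r. card (?H k))"
    unfolding S by (rule card_UN_disjoint) auto
  also have "\<dots> = sum_list (diagonal_hooks l)"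
    using cardH by (simp add: diagonal_hooks_def interv_sum_list_conv_sum_set_nat atLeast0LessThan)
  finally show ?thesis by simp
qed

subsection \<open>Twisted immanants\<close>

text \<open>Exchanging the sums over index words and permutations isolates the contribution of each
  permutation. It is the same for all permutations of type \<open>diagonal_hooks l\<close>, so only
  their number enters the remaining scalar.\<close>

lemma twisted_imm_sum_eq:
  fixes A :: "'a::complex_algebra mat"
  assumes A: "A \<in> carrier_mat N N" and anti: "anticommuting (elements_mat A)"
    and sc: "self_conjugate_partition n l"
  shows "prod_list (map (\<lambda>k. trace (mat_power A k)) (diagonal_hooks l)) =
      (\<i> powi (- int (half_defect l)) * complex_of_real (sqrt (real (prod_list (diagonal_hooks l)))))
        *\<^sub>C twisted_imm_sum n l A"
proof -
  define ms where "ms = diagonal_hooks l"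
  define T where "T = prod_list (map (\<lambda>k. trace (mat_power A k)) ms)"
  define q where "q = complex_of_real (sqrt (real (prod_list ms)))"
  define m where "m = half_defect l"
  let ?P = "{s. s permutes {0..<n}}"
  let ?C = "{s. has_cycle_type n ms s}"
  let ?g = "\<lambda>I s. prod_list (map (\<lambda>i. A $$ (I ! i, I ! s i)) [0..<n])"
  have p: "partition_of n l" using sc by (simp add: self_conjugate_partition_def)
  then have sl: "sum_list l = n" by (simp add: partition_of_def)
  have ms: "distinct ms" "0 \<notin> set ms" "sum_list ms = n"
    using diagonal_hooks_distinct[OF p] sum_diagonal_hooks[OF sc] by (simp_all add: ms_def)
  have sub: "?C \<subseteq> ?P"
    by (auto simp: has_cycle_type_def dest: cycle_form_permutes)
  have contrib: "(\<Sum>I\<in>words N n. twisted_char l s *\<^sub>C ?g I s) = (if s \<in> ?C then (\<i> ^ m * q) *\<^sub>C T else 0)" for s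
  proof (cases "has_cycle_type n ms s")
    case True
    define cs where "cs = (SOME cs. cycle_form n ms s cs)"
    have cf: "cycle_form n ms s cs"
      using True unfolding has_cycle_type_def cs_def by (rule someI_ex)
    have sum: "(\<Sum>I\<in>words N n. ?g I s) = signed (inversions (concat cs)) T"
      using cycle_form_sum[OF A anti cf ms(2,3)] by (simp add: T_def)
    have "twisted_char l s = (if even (inversions (concat cs)) then 1 else -1) * (\<i> ^ m * q)"
      using True by (simp add: twisted_char_def sl ms_def[symmetric] cycle_sign_def cs_def q_def m_def Let_def)
    \<comment> \<open>The sign in the character and the sign from reordering come from the same
      cycle form and cancel.\<close>
    then show ?thesis using True
      by (simp add: scaleC_sum_right[symmetric] sum signed_def scaleC_minus_left scaleC_minus_right)
  next
    case False
    then show ?thesis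
      by (simp add: twisted_char_def sl ms_def[symmetric] scaleC_zero_left)
  qed
  have "twisted_imm l (index_mat_by A I) = (\<Sum>s\<in>?P. twisted_char l s *\<^sub>C ?g I s)"
    if I: "I \<in> words N n" for I
  proof -
    have "index_mat_by A I $$ (i, s i) = A $$ (I ! i, I ! s i)" if "s \<in> ?P" "i < n" for s i
      using that I permutes_in_image[of s "{0..<n}" i] by (simp add: index_mat_by_def)
    moreover have "dim_row (index_mat_by A I) = n" using I by (simp add: index_mat_by_def)
    ultimately show ?thesis unfolding twisted_imm_def
      by (intro sum.cong) (auto intro!: arg_cong[where f = "scaleC _"] arg_cong[where f = prod_list])
  qed
  then have "(\<Sum>I\<in>words N n. twisted_imm l (index_mat_by A I))
      = (\<Sum>I\<in>words N n. \<Sum>s\<in>?P. twisted_char l s *\<^sub>C ?g I s)"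
    by (intro sum.cong) auto
  also have "\<dots> = (\<Sum>s\<in>?P. if s \<in> ?C then (\<i> ^ m * q) *\<^sub>C T else 0)"
    by (subst sum.swap) (simp only: contrib)
  also have "\<dots> = (\<Sum>s\<in>?C. (\<i> ^ m * q) *\<^sub>C T)"
    by (simp only: sum.inter_restrict[symmetric, OF finite_permutations[OF finite_atLeastLessThan]]
        Int_absorb1[OF sub])
  finally have "twisted_imm_sum n l A
      = (1 / fact n * (of_nat (card ?C) * (\<i> ^ m * q))) *\<^sub>C T"
    using A by (simp add: twisted_imm_sum_def sum_const_scaleC scaleC_scaleC)
  then have "(\<i> powi (- int m) * q) *\<^sub>C twisted_imm_sum n l A
      = (\<i> powi (- int m) * q * (1 / fact n * (of_nat (card ?C) * (\<i> ^ m * q)))) *\<^sub>C T"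
    by (simp add: scaleC_scaleC)
  \<comment> \<open>The powers of the imaginary unit cancel, and the two square roots multiply to
    \<open>prod_list ms\<close>, which times the number of permutations is n!.\<close>
  also have "\<i> powi (- int m) * q * (1 / fact n * (of_nat (card ?C) * (\<i> ^ m * q))) = 1"
  proof -
    have i: "\<i> powi (- int m) * \<i> ^ m = 1" by (simp add: power_int_minus)
    have q: "q * q = of_nat (prod_list ms)"
      unfolding q_def by (simp flip: of_real_mult)
    have c: "of_nat (card ?C) * of_nat (prod_list ms) = (fact n :: complex)"
      using arg_cong[OF card_has_cycle_type[OF ms], of "of_nat :: nat \<Rightarrow> complex"] by simp
    have "\<i> powi (- int m) * q * (1 / fact n * (of_nat (card ?C) * (\<i> ^ m * q)))
        = (\<i> powi (- int m) * \<i> ^ m) * (of_nat (card ?C) * (q * q)) / fact n"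
      by simp
    then show ?thesis by (simp only: i q c) simp
  qed
  finally show ?thesis by (simp add: scaleC_one T_def ms_def q_def m_def)
qed

section \<open>Hook partitions and the trace of an odd power\<close>

lemma self_conjugate_hook:
  "self_conjugate_partition (2 * k + 1) ((k + 1) # replicate k 1)"
proof -
  let ?l = "(k + 1) # replicate k 1"
  have "partition_of (2 * k + 1) ?l"
    by (auto simp: partition_of_def sum_list_replicate sorted_wrt_iff_nth_less nth_Cons split: nat.splits)
  moreover have "conjugate ?l = ?l"
    by (rule nth_equalityI) (auto simp: conjugate_def nth_Cons' filter_replicate nth_append simp del: upt_Suc)
  ultimately show ?thesis by (simp add: self_conjugate_partition_def)
qed

text \<open>Only the corner cell lies on the diagonal: a part with index \<open>j > 0\<close> is 1,
  which does not exceed \<open>j\<close>.\<close>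

lemma diagonal_rank_hook: "diagonal_rank ((k + 1) # replicate k 1) = 1"
proof -
  have "{j. j < length ((k + 1) # replicate k 1) \<and> j < ((k + 1) # replicate k 1) ! j} = {0}"
  proof (intro Set.set_eqI iffI)
    fix j assume "j \<in> {j. j < length ((k + 1) # replicate k 1) \<and> j < ((k + 1) # replicate k 1) ! j}"
    then show "j \<in> {0}" by (cases j) auto
  qed auto
  then show ?thesis by (simp add: diagonal_rank_def)
qed

theorem theorem1p2:
  fixes A :: "'a::complex_algebra mat" and N :: nat
  assumes "A \<in> carrier_mat N N"
    and "anticommuting (elements_mat A)"
  shows "(\<forall>n l. self_conjugate_partition n l \<longrightarrow>
            prod_list (map (\<lambda>k. trace (mat_power A k)) (diagonal_hooks l)) =
              (\<i> powi (- int (half_defect l))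
                 * complex_of_real (sqrt (real (prod_list (diagonal_hooks l)))))
              *\<^sub>C twisted_imm_sum n l A)
       \<and> (\<forall>k. trace (mat_power A (2 * k + 1)) =
              (\<i> powi (- int k) * complex_of_real (sqrt (real (2 * k + 1))))
              *\<^sub>C twisted_imm_sum (2 * k + 1) ((k + 1) # replicate k 1) A)"
proof (intro conjI allI impI)
  fix k
  let ?l = "(k + 1) # replicate k 1"
  \<comment> \<open>The whole diagram is one diagonal hook, of length 2(k+1) - 1, so the half defect
    is ((2k+1) - 1)/2 = k.\<close>
  have hooks: "diagonal_hooks ?l = [2 * k + 1]"
    unfolding diagonal_hooks_def diagonal_rank_hook by simp
  have half: "half_defect ?l = k"
    unfolding half_defect_def diagonal_rank_hook by (simp add: sum_list_replicate)
  from twisted_imm_sum_eq[OF assms self_conjugate_hook[of k]]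
  show "trace (mat_power A (2 * k + 1)) =
      (\<i> powi (- int k) * complex_of_real (sqrt (real (2 * k + 1))))
        *\<^sub>C twisted_imm_sum (2 * k + 1) ?l A"
    unfolding hooks half by simp
qed (rule twisted_imm_sum_eq[OF assms])

end
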